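(* Let $k_0\ge0$ be a fixed integer. The reduction algorithm (defined in the context), applied to the Vietoris-Rips complex based on a binomial point process of $n$ points on the torus $\mathbb{T}^d_a$ in the critical regime $\theta\sim\frac1n$, has asymptotically almost surely (as $n\to\infty$) a complexity in $$O(n^{\ln n}).$$
   Context: Setting. $\mathbb{T}^d_a$ is the $d$-dimensional torus of side $a$, with the distance induced by the uniform norm $\|x\|_\infty=\max_i|x_i|$. A binomial point process of $n$ points is a set of $n$ independent uniformly distributed points on $\mathbb{T}^d_a$. The Vietoris-Rips complex on these points is the abstract simplicial complex whose $k$-simplices are the sets of $k+1$ points that are pairwise within the connection distance $r$ of each other. Put $\theta=(r/a)^d$, which depends on $n$, and assume $\theta\le(1/2)^d$. For non-negative functions, $f(n)\sim g(n)$ means $f(n)=O(g(n))$ and $g(n)=O(f(n))$ as $n\to\infty$. A property holds asymptotically almost surely if its probability tends to $1$ as $n\to\infty$. Simplicial notions. A $k$-simplex has $k+1$ vertices; a coface of a simplex is a simplex containing it. $\beta_k(S)$ is the dimension of $H_k(S)$ (simplicial homology over a field). The degree of a simplex $\sigma$ of $S$ is $D(\sigma)=\max\{d' : \sigma\subset\tau \text{ for some } d'\text{-simplex }\tau\text{ of }S\}$. The index of a $0$-simplex $x$ is $I(x)=\min\{D(\sigma):\sigma \text{ a }(k_0+1)\text{-simplex of }S\text{ containing }x\}$, with $I(x)=0$ if there is none. Reduction algorithm. Input: complex $S$, list $L$ of critical $0$-simplices, integer $k_0$. Compute $\beta_0(S),\dots,\beta_{k_0}(S)$, the degrees of all $(k_0+1)$-simplices,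 and the indices of all $0$-simplices; then set $I(x)=-1$ for every $x\in L$. Let $I_{\max}$ denote the maximum of the current indices. While $I_{\max}>k_0+1$: draw uniformly at random a $0$-simplex $\hat x$ with $I(\hat x)=I_{\max}$; let $S'$ be $S$ with $\hat x$ and all its cofaces removed; compute $\beta_0(S'),\dots,\beta_{k_0}(S')$. If $\beta_k(S')\ne\beta_k(S)$ for some $k\in\{0,\dots,k_0\}$, cancel the removal (keep $S$) and set $I(\hat x)=-1$. Otherwise, replace $S$ by $S'$, recompute the degrees of the $(k_0+1)$-simplices and the indices of all $0$-simplices whose current index is not $-1$. Update $I_{\max}$. When the loop ends, output $S$. Complexity means worst-case number of elementary operations. The complex is given by the list of all its simplices; field operations and inclusion tests between simplices have unit cost; Betti numbers are computed from the ranks of the boundary matrices, and the rank of an $n\times m$ matrix costs $O(nm\min(n,m))$. *)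

theory Defs
  imports "HOL-Probability.Probability" "HOL-Library.Poly_Mapping" "HOL-Library.Landau_Symbols"
begin

section \<open>Simplicial complexes and their homology over a field\<close>

text \<open>An abstract simplicial complex is the set of its simplices, which are nonempty finite sets.\<close>

definition simplices :: "nat \<Rightarrow> 'v set set \<Rightarrow> 'v set set" where
  "simplices k S = {\<sigma> \<in> S. card \<sigma> = Suc k}"

definition vertices :: "'v set set \<Rightarrow> 'v set" where
  "vertices S = {v. {v} \<in> S}"

text \<open>
  The simplices are oriented by the linear order of the vertices: removing the vertex \<open>v\<close>
  from \<open>\<sigma>\<close> carries the sign \<open>(-1) ^ i\<close>, where \<open>i\<close> is the position of \<open>v\<close> in \<open>\<sigma>\<close>.
  As the empty simplex is excluded, the homology is not reduced.
\<close>

definition boundary ::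
    "nat \<Rightarrow> ('v::linorder set \<Rightarrow>\<^sub>0 'f::field) \<Rightarrow> ('v set \<Rightarrow>\<^sub>0 'f)" where
  "boundary k c = (if k = 0 then 0 else
     (\<Sum>\<sigma>\<in>Poly_Mapping.keys c. \<Sum>v\<in>\<sigma>.
        Poly_Mapping.single (\<sigma> - {v}) ((-1) ^ card {u\<in>\<sigma>. u < v} * Poly_Mapping.lookup c \<sigma>)))"

definition chains :: "nat \<Rightarrow> 'v set set \<Rightarrow> ('v set \<Rightarrow>\<^sub>0 'f::field) set" where
  "chains k S = {c. Poly_Mapping.keys c \<subseteq> simplices k S}"

definition cycles :: "nat \<Rightarrow> 'v::linorder set set \<Rightarrow> ('v set \<Rightarrow>\<^sub>0 'f::field) set" where
  "cycles k S = {c \<in> chains k S. boundary k c = 0}"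

definition boundaries :: "nat \<Rightarrow> 'v::linorder set set \<Rightarrow> ('v set \<Rightarrow>\<^sub>0 'f::field) set" where
  "boundaries k S = boundary (Suc k) ` chains (Suc k) S"

definition chain_scale :: "'f::field \<Rightarrow> ('v set \<Rightarrow>\<^sub>0 'f) \<Rightarrow> ('v set \<Rightarrow>\<^sub>0 'f)" where
  "chain_scale a c = Poly_Mapping.map ((*) a) c"

lemma lookup_chain_scale:
  "Poly_Mapping.lookup (chain_scale a c) \<sigma> = a * Poly_Mapping.lookup c \<sigma>"
  by (simp add: chain_scale_def Poly_Mapping.map.rep_eq when_def)

lemma vector_space_chain_scale: "vector_space chain_scale"
  by unfold_locales
     (simp_all add: poly_mapping_eq_iff fun_eq_iff lookup_chain_scale lookup_add algebra_simps)

text \<open>The dimension of the quotient of the space of cycles by the space of boundaries.\<close>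

definition betti :: "'f::field itself \<Rightarrow> nat \<Rightarrow> 'v::linorder set set \<Rightarrow> nat" where
  "betti _ k S =
     vector_space.dim chain_scale (cycles k S :: ('v set \<Rightarrow>\<^sub>0 'f) set)
     - vector_space.dim chain_scale (boundaries k S :: ('v set \<Rightarrow>\<^sub>0 'f) set)"


section \<open>The reduction algorithm\<close>

definition simplex_degree :: "'v set set \<Rightarrow> 'v set \<Rightarrow> nat" where
  "simplex_degree S \<sigma> = Max {d. \<exists>\<tau>\<in>simplices d S. \<sigma> \<subseteq> \<tau>}"

definition vertex_index :: "nat \<Rightarrow> 'v set set \<Rightarrow> 'v \<Rightarrow> int" where
  "vertex_index k0 S x =
     (let T = {\<sigma> \<in> simplices (Suc k0) S. x \<in> \<sigma>}
      in if T = {} then 0 else int (Min (simplex_degree S ` T)))"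

text \<open>Indices are at least \<open>-1\<close>, so inserting \<open>-1\<close> only matters if there is no vertex.\<close>

definition max_index :: "'v set set \<Rightarrow> ('v \<Rightarrow> int) \<Rightarrow> int" where
  "max_index S I = Max (insert (-1) (I ` vertices S))"

definition remove_vertex :: "'v \<Rightarrow> 'v set set \<Rightarrow> 'v set set" where
  "remove_vertex x S = {\<sigma> \<in> S. x \<notin> \<sigma>}"

definition draw :: "'v set set \<Rightarrow> ('v \<Rightarrow> int) \<Rightarrow> 'v pmf" where
  "draw S I = pmf_of_set {x \<in> vertices S. I x = max_index S I}"

definition preserves_betti :: "'f::field itself \<Rightarrow> nat \<Rightarrow> 'v::linorder set set \<Rightarrow> 'v set set \<Rightarrow> bool" where
  "preserves_betti F k0 S S' \<longleftrightarrow> (\<forall>k\<le>k0. betti F k S' = betti F k S)"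


subsection \<open>Numbers of elementary operations\<close>

text \<open>
  A complex is stored as the list of all its simplices, of length \<open>card S\<close>.  The parameter
  \<open>rc\<close> is the cost of the rank procedure: \<open>rc p q\<close> operations for a \<open>p \<times> q\<close> matrix.

  Betti numbers: sort out the simplices of each dimension up to \<open>k0 + 1\<close> by scanning the list;
  fill in each entry of the boundary matrices in dimensions 1 to \<open>k0 + 1\<close> (an inclusion test and
  an assignment of a coefficient); compute the ranks of these matrices; two subtractions for each
  Betti number (number of simplices minus two ranks).
\<close>

definition betti_cost :: "(nat \<Rightarrow> nat \<Rightarrow> nat) \<Rightarrow> nat \<Rightarrow> 'v set set \<Rightarrow> nat" where
  "betti_cost rc k0 S =
     (k0 + 2) * card S
     + (\<Sum>k=1..k0+1. 2 * (card (simplices (k - 1) S) * card (simplices k S))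
                     + rc (card (simplices (k - 1) S)) (card (simplices k S)))
     + 2 * (k0 + 1)"

text \<open>
  Degrees: sort out the \<open>(k0 + 1)\<close>-simplices; for each of them and each simplex of the list an
  inclusion test and an update of the maximum.
\<close>

definition degree_cost :: "nat \<Rightarrow> 'v set set \<Rightarrow> nat" where
  "degree_cost k0 S = card S + 2 * (card (simplices (Suc k0) S) * card S)"

text \<open>
  Indices: for each vertex a test whether its index is \<open>-1\<close>; then, for each
  \<open>(k0 + 1)\<close>-simplex, an inclusion test and an update of the minimum.
\<close>

definition index_cost :: "nat \<Rightarrow> 'v set set \<Rightarrow> nat" where
  "index_cost k0 S = card (vertices S) * (1 + 2 * card (simplices (Suc k0) S))"

text \<open>Computation of the maximal index and its comparison with \<open>k0 + 1\<close>.\<close>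

definition max_cost :: "'v set set \<Rightarrow> nat" where
  "max_cost S = card (vertices S) + 1"

definition init_cost :: "(nat \<Rightarrow> nat \<Rightarrow> nat) \<Rightarrow> nat \<Rightarrow> 'v set set \<Rightarrow> 'v list \<Rightarrow> nat" where
  "init_cost rc k0 S L =
     betti_cost rc k0 S + degree_cost k0 S + index_cost k0 S + length L + max_cost S"

text \<open>
  A tentative removal: collect the vertices of maximal index and draw one of them; test for each
  simplex of the list whether it contains that vertex; compute the Betti numbers of the new
  complex and compare them with the old ones.
\<close>

definition removal_cost :: "(nat \<Rightarrow> nat \<Rightarrow> nat) \<Rightarrow> nat \<Rightarrow> 'v set set \<Rightarrow> 'v set set \<Rightarrow> nat" where
  "removal_cost rc k0 S S' =
     card (vertices S) + 1 + card S + betti_cost rc k0 S' + (k0 + 1)"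

definition cancel_cost :: "'v set set \<Rightarrow> nat" where
  "cancel_cost S = 1 + max_cost S"

definition accept_cost :: "nat \<Rightarrow> 'v set set \<Rightarrow> nat" where
  "accept_cost k0 S' = card S' + degree_cost k0 S' + index_cost k0 S' + max_cost S'"


subsection \<open>Executions\<close>

datatype 'v config = Loop "'v set set" "'v \<Rightarrow> int" | Output "'v set set"

text \<open>
  \<open>step F rc k0 s c s'\<close>: the configuration \<open>s\<close> can pass to \<open>s'\<close> with \<open>c\<close> elementary operations.
  All possible outcomes of the random draw are allowed.
\<close>

inductive step ::
    "'f::field itself \<Rightarrow> (nat \<Rightarrow> nat \<Rightarrow> nat) \<Rightarrow> nat \<Rightarrow>
     'v::linorder config \<Rightarrow> nat \<Rightarrow> 'v config \<Rightarrow> bool"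
  for F :: "'f::field itself" and rc :: "nat \<Rightarrow> nat \<Rightarrow> nat" and k0 :: nat
where
  cancel:
    "\<lbrakk>max_index S I > int k0 + 1; x \<in> set_pmf (draw S I); S' = remove_vertex x S;
      \<not> preserves_betti F k0 S S'\<rbrakk>
     \<Longrightarrow> step F rc k0 (Loop S I) (removal_cost rc k0 S S' + cancel_cost S) (Loop S (I(x := -1)))"
| accept:
    "\<lbrakk>max_index S I > int k0 + 1; x \<in> set_pmf (draw S I); S' = remove_vertex x S;
      preserves_betti F k0 S S'\<rbrakk>
     \<Longrightarrow> step F rc k0 (Loop S I) (removal_cost rc k0 S S' + accept_cost k0 S')
           (Loop S' (\<lambda>y. if I y = -1 then -1 else vertex_index k0 S' y))"
| halt:
    "max_index S I \<le> int k0 + 1 \<Longrightarrow> step F rc k0 (Loop S I) (card S) (Output S)"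

text \<open>
  \<open>reaches F rc k0 S L c s\<close>: started with the input \<open>S\<close>, \<open>L\<close>, the algorithm can reach the
  configuration \<open>s\<close> after \<open>c\<close> elementary operations.
\<close>

inductive reaches ::
    "'f::field itself \<Rightarrow> (nat \<Rightarrow> nat \<Rightarrow> nat) \<Rightarrow> nat \<Rightarrow>
     'v::linorder set set \<Rightarrow> 'v list \<Rightarrow> nat \<Rightarrow> 'v config \<Rightarrow> bool"
  for F :: "'f::field itself" and rc :: "nat \<Rightarrow> nat \<Rightarrow> nat" and k0 :: nat
    and S :: "'v::linorder set set" and L :: "'v list"
where
  init:
    "reaches F rc k0 S L (init_cost rc k0 S L)
       (Loop S (\<lambda>x. if x \<in> set L then -1 else vertex_index k0 S x))"
| step:
    "\<lbrakk>reaches F rc k0 S L c s; step F rc k0 s c' s'\<rbrakk> \<Longrightarrow> reaches F rc k0 S L (c + c') s'"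

text \<open>
  The worst case is taken over all lists \<open>L\<close> of critical vertices and all draws.  The supremum
  ranges over partial executions as well, so it would be infinite if the number of operations
  were unbounded, in particular if the loop did not terminate.
\<close>

definition complexity ::
    "'f::field itself \<Rightarrow> (nat \<Rightarrow> nat \<Rightarrow> nat) \<Rightarrow> nat \<Rightarrow> 'v::linorder set set \<Rightarrow> ereal" where
  "complexity F rc k0 S =
     Sup {ereal (real c) | c L s.
            distinct L \<and> set L \<subseteq> vertices S \<and> reaches F rc k0 S L c s}"


section \<open>Random Vietoris-Rips complexes on the torus\<close>

text \<open>
  The torus of side \<open>a\<close> is the quotient of \<open>real ^ 'd\<close> by the lattice of all points with
  coordinates in \<open>a \<int>\<close>; its points are represented in the fundamental domain \<open>[0, a)\<close> to
  the power \<open>'d\<close>, and \<open>torus_dist\<close> is the quotient distance of the uniform norm.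
\<close>

definition torus :: "real \<Rightarrow> (real ^ 'd::finite) set" where
  "torus a = {x. \<forall>i. 0 \<le> x $ i \<and> x $ i < a}"

definition torus_dist :: "real \<Rightarrow> real ^ 'd::finite \<Rightarrow> real ^ 'd \<Rightarrow> real" where
  "torus_dist a x y = (INF z\<in>{z. \<forall>i. z $ i \<in> \<int>}. infnorm (x - y + a *\<^sub>R z))"

text \<open>
  The points are indexed by \<open>{..<n}\<close>.  They are almost surely distinct, so that their indices
  can serve as vertices.
\<close>

definition binomial_process :: "real \<Rightarrow> nat \<Rightarrow> (nat \<Rightarrow> real ^ 'd::finite) measure" where
  "binomial_process a n = Pi\<^sub>M {..<n} (\<lambda>_. uniform_measure lborel (torus a))"

definition vietoris_rips :: "('v \<Rightarrow> 'v \<Rightarrow> real) \<Rightarrow> 'v set \<Rightarrow> real \<Rightarrow> 'v set set" where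
  "vietoris_rips \<delta> V r =
     {\<sigma>. \<sigma> \<subseteq> V \<and> finite \<sigma> \<and> \<sigma> \<noteq> {} \<and> (\<forall>x\<in>\<sigma>. \<forall>y\<in>\<sigma>. x \<noteq> y \<longrightarrow> \<delta> x y \<le> r)}"

definition torus_rips :: "real \<Rightarrow> real \<Rightarrow> nat \<Rightarrow> (nat \<Rightarrow> real ^ 'd::finite) \<Rightarrow> nat set set" where
  "torus_rips a r n X = vietoris_rips (\<lambda>i j. torus_dist a (X i) (X j)) {..<n} r"

end

theory Submission
  imports Defs
begin

text \<open>
  A set of \<open>k\<close> points is a simplex with probability at most \<open>q ^ (k - 1)\<close>, where \<open>q\<close> is of order
  \<open>\<theta>\<close>, because all its points lie within distance \<open>r\<close> of the first one.  Hence the expected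
  number of simplices is at most \<open>(1 + q) ^ n / q\<close>, which is linear in \<open>n\<close> in the critical
  regime, and by Markov's inequality there are asymptotically almost surely fewer than \<open>n\<^sup>2\<close>
  simplices.  Every passage through the loop deactivates a vertex, so the algorithm performs a
  number of operations that is polynomial in the number of simplices, hence in \<open>n\<close>.
\<close>

section \<open>Cost of the reduction algorithm\<close>

lemma card_simplices_le:
  assumes "finite S"
  shows "card (simplices k S) \<le> card S"
  using assms by (auto simp: simplices_def intro: card_mono)

lemma
  assumes "finite S"
  shows finite_vertices: "finite (vertices S)"
    and card_vertices_le: "card (vertices S) \<le> card S"
proof -
  have inj: "inj_on (\<lambda>v. {v}) (vertices S)" and sub: "(\<lambda>v. {v}) ` vertices S \<subseteq> S"
    by (auto simp: vertices_def inj_on_def)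
  show "finite (vertices S)"
    by (rule inj_on_finite[OF inj sub assms])
  show "card (vertices S) \<le> card S"
    by (rule card_inj_on_le[OF inj sub assms])
qed

section \<open>Active vertices and the progress of the loop\<close>

lemma vertices_remove_vertex: "vertices (remove_vertex x S) = vertices S - {x}"
  by (auto simp: vertices_def remove_vertex_def)

text \<open>A maximum above -1 differs from the inserted default, so some vertex attains it. The set
  drawn from is then finite and nonempty, which is what gives \<open>pmf_of_set\<close> its intended
  support.\<close>

lemma draw_active:
  assumes "finite S" and "max_index S I > -1" and "x \<in> set_pmf (draw S I)"
  shows "x \<in> vertices S" and "I x \<noteq> -1"
proof -
  let ?A = "{x \<in> vertices S. I x = max_index S I}"
  have fin: "finite (vertices S)"
    by (rule finite_vertices[OF assms(1)])
  have "max_index S I \<in> insert (-1) (I ` vertices S)"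
    unfolding max_index_def using fin by (intro Max_in) auto
  with assms(2) have "?A \<noteq> {}"
    by auto
  with fin assms(3) have "x \<in> ?A"
    unfolding draw_def by (subst (asm) set_pmf_of_set) auto
  with assms(2) show "x \<in> vertices S" "I x \<noteq> -1"
    by auto
qed

text \<open>The vertices still in play: those neither critical nor already the subject of a
  cancelled removal.\<close>

definition active :: "'v set set \<Rightarrow> ('v \<Rightarrow> int) \<Rightarrow> 'v set" where
  "active S I = {v \<in> vertices S. I v \<noteq> -1}"

lemma finite_active: "finite S \<Longrightarrow> finite (active S I)"
  using finite_vertices[of S] by (simp add: active_def)

lemma card_active_cancel:
  assumes "finite S" and "max_index S I > -1" and "x \<in> set_pmf (draw S I)"
  shows "Suc (card (active S (I(x := -1)))) \<le> card (active S I)"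
proof -
  have "active S (I(x := -1)) = active S I - {x}"
    by (auto simp: active_def)
  moreover have "x \<in> active S I"
    using draw_active[OF assms] by (simp add: active_def)
  ultimately show ?thesis
    using card_Suc_Diff1[OF finite_active[OF assms(1)], of x I] by simp
qed

text \<open>\<open>J\<close> stands for the recomputed indices. Their values are irrelevant, because
  an index of -1 is kept and so recomputation cannot reactivate a vertex, while the drawn vertex
  disappears.\<close>

lemma card_active_accept:
  assumes "finite S" and "max_index S I > -1" and "x \<in> set_pmf (draw S I)"
  shows "Suc (card (active (remove_vertex x S) (\<lambda>y. if I y = -1 then -1 else J y)))
           \<le> card (active S I)"
proof -
  have "active (remove_vertex x S) (\<lambda>y. if I y = -1 then -1 else J y) \<subseteq> active S I - {x}"
    by (auto simp: active_def vertices_remove_vertex split: if_splits)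
  then have "card (active (remove_vertex x S) (\<lambda>y. if I y = -1 then -1 else J y))
      \<le> card (active S I - {x})"
    using finite_active[OF assms(1)] by (intro card_mono) auto
  moreover have "x \<in> active S I"
    using draw_active[OF assms] by (simp add: active_def)
  then have "Suc (card (active S I - {x})) = card (active S I)"
    using finite_active[OF assms(1)] by (intro card_Suc_Diff1)
  ultimately show ?thesis
    by linarith
qed

section \<open>Cubic bounds on the individual phases\<close>

lemma degree_cost_le:
  assumes "finite S" and "card S < M"
  shows "degree_cost k0 S \<le> 3 * M ^ 3"
proof -
  have "card (simplices (Suc k0) S) * card S \<le> M * M"
    using card_simplices_le[OF assms(1), of "Suc k0"] assms(2) by (intro mult_le_mono) auto
  moreover have "M \<le> M ^ 3" "M * M \<le> M ^ 3"
    using assms(2) by (auto simp: power3_eq_cube)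
  ultimately show ?thesis
    using assms(2) unfolding degree_cost_def by linarith
qed

lemma index_cost_le:
  assumes "finite S" and "card S < M"
  shows "index_cost k0 S \<le> 3 * M ^ 3"
proof -
  have "card (vertices S) * card (simplices (Suc k0) S) \<le> M * M"
    using card_simplices_le[OF assms(1), of "Suc k0"] card_vertices_le[OF assms(1)] assms(2)
    by (intro mult_le_mono) auto
  moreover have "M \<le> M ^ 3" "M * M \<le> M ^ 3"
    using assms(2) by (auto simp: power3_eq_cube)
  ultimately show ?thesis
    using card_vertices_le[OF assms(1)] assms(2) unfolding index_cost_def
    by (simp add: algebra_simps)
qed

text \<open>The strict bound \<open>card S < M\<close> absorbs the extra comparison: the number of
  vertices plus one is still at most \<open>M\<close>.\<close>

lemma max_cost_le:
  assumes "finite S" and "card S < M"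
  shows "max_cost S \<le> M ^ 3"
proof -
  have "M \<le> M ^ 3"
    using assms(2) by (auto simp: power3_eq_cube)
  then show ?thesis
    using card_vertices_le[OF assms(1)] assms(2) unfolding max_cost_def by linarith
qed

context
  fixes rc :: "nat \<Rightarrow> nat \<Rightarrow> nat" and K k0 :: nat
  assumes rc: "\<And>p q. rc p q \<le> K * (p * q * min p q)"
begin

text \<open>The rank computations dominate: a boundary matrix has at most \<open>M\<close> rows and
  \<open>M\<close> columns, hence costs at most \<open>K * M ^ 3\<close>, and there are
  \<open>k0 + 1\<close> of them. All other work is at most quadratic in \<open>M\<close> for fixed
  \<open>k0\<close>.\<close>

lemma betti_cost_le:
  assumes "finite S" and "card S < M"
  shows "betti_cost rc k0 S \<le> (k0 + 2) * (K + 5) * M ^ 3"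
proof -
  define T where "T = M ^ 3"
  have M: "M \<ge> 1" using assms(2) by simp
  have MT: "M \<le> T" "M * M \<le> T" "1 \<le> T"
    using M unfolding T_def power3_eq_cube by auto
  have "(\<Sum>k=1..k0+1. 2 * (card (simplices (k - 1) S) * card (simplices k S))
          + rc (card (simplices (k - 1) S)) (card (simplices k S)))
      \<le> (\<Sum>k=1..k0+1. (2 + K) * T)"
  proof (rule sum_mono)
    fix k
    define p q where "p = card (simplices (k - 1) S)" and "q = card (simplices k S)"
    have p: "p \<le> M" and q: "q \<le> M"
      using card_simplices_le[OF assms(1), of "k - 1"] card_simplices_le[OF assms(1), of k] assms(2)
      unfolding p_def q_def by linarith+
    have pq: "p * q \<le> M * M"
      using p q by (intro mult_le_mono)
    then have "p * q * min p q \<le> M * M * M"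
      using p by (rule mult_le_mono[OF _ min.coboundedI1])
    then have "rc p q \<le> K * T"
      using rc[of p q] unfolding T_def power3_eq_cube by (meson le_trans mult_le_mono2)
    with pq MT have "2 * (p * q) + rc p q \<le> (2 + K) * T"
      by (simp add: algebra_simps)
    then show "2 * (card (simplices (k - 1) S) * card (simplices k S))
          + rc (card (simplices (k - 1) S)) (card (simplices k S)) \<le> (2 + K) * T"
      unfolding p_def q_def .
  qed
  also have "\<dots> = (k0 + 1) * ((2 + K) * T)"
    by simp
  finally have "betti_cost rc k0 S
      \<le> (k0 + 2) * card S + (k0 + 1) * ((2 + K) * T) + 2 * (k0 + 1)"
    unfolding betti_cost_def by linarith
  \<comment> \<open>Scanning, matrices and subtractions get the common factor \<open>k0 + 2\<close>;
    their weights 1, \<open>2 + K\<close> and 2 add up to \<open>K + 5\<close>.\<close>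
  also have "\<dots> \<le> (k0 + 2) * T + (k0 + 2) * ((2 + K) * T) + (k0 + 2) * (2 * T)"
  proof (intro add_mono)
    show "(k0 + 2) * card S \<le> (k0 + 2) * T"
      using MT assms(2) by (intro mult_le_mono2) linarith
    show "(k0 + 1) * ((2 + K) * T) \<le> (k0 + 2) * ((2 + K) * T)"
      by (intro mult_le_mono1) simp
    show "2 * (k0 + 1) \<le> (k0 + 2) * (2 * T)"
      using mult_le_mono[of "k0 + 1" "k0 + 2" 2 "2 * T"] MT by (simp add: mult.commute)
  qed
  also have "\<dots> = (k0 + 2) * (K + 5) * T"
    by (simp add: algebra_simps)
  finally show ?thesis
    unfolding T_def .
qed

text \<open>One bound for the initialisation, for a passage through the loop and for the output. In
  \<open>K + 15\<close>, the part \<open>K + 5\<close> pays for the Betti numbers and 10 for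
  everything else.\<close>

definition step_bound :: "nat \<Rightarrow> nat" where
  "step_bound M = (k0 + 2) * (K + 15) * M ^ 3"

lemma step_bound_ge: "(k0 + 2) * (K + 5) * M ^ 3 + (k0 + 2) * (10 * M ^ 3) \<le> step_bound M"
  by (simp add: step_bound_def algebra_simps)

lemma init_cost_le:
  assumes "finite S" and "card S < M" and "distinct L" and "set L \<subseteq> vertices S"
  shows "init_cost rc k0 S L \<le> step_bound M"
proof -
  have "length L \<le> card (vertices S)"
    using assms finite_vertices[of S] by (metis card_mono distinct_card)
  then have "length L \<le> card S"
    using card_vertices_le[OF assms(1)] by linarith
  moreover have "M \<le> M ^ 3"
    using assms(2) by (auto simp: power3_eq_cube)
  moreover have "2 * (10 * M ^ 3) \<le> (k0 + 2) * (10 * M ^ 3)"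
    by (intro mult_le_mono) auto
  ultimately show ?thesis
    using betti_cost_le[OF assms(1,2)] degree_cost_le[OF assms(1,2), of k0]
      index_cost_le[OF assms(1,2), of k0]
      max_cost_le[OF assms(1,2)] step_bound_ge[of M] assms(2)
    unfolding init_cost_def by linarith
qed

text \<open>The maximum covers both outcomes of a tentative removal, so that cancelled and accepted
  passages are charged the same amount.\<close>

lemma removal_cost_le:
  assumes "finite S" and "card S < M" and "finite S'" and "card S' < M"
  shows "removal_cost rc k0 S S' + max (cancel_cost S) (accept_cost k0 S') \<le> step_bound M"
proof -
  have M: "M \<le> M ^ 3" "1 \<le> M ^ 3"
    using assms(2) by (auto simp: power3_eq_cube)
  have "(k0 + 1) * 1 \<le> (k0 + 1) * M ^ 3"
    using M by (intro mult_le_mono) auto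
  \<comment> \<open>The comparisons of Betti numbers contribute \<open>k0 + 1\<close>, which is not
    bounded in terms of \<open>M\<close>; the factor \<open>k0 + 2\<close> of the reserve takes care
    of it.\<close>
  then have "18 * M ^ 3 + (k0 + 1) \<le> (k0 + 2) * (10 * M ^ 3)"
    by (simp add: algebra_simps)
  moreover have "max (cancel_cost S) (accept_cost k0 S') \<le> 8 * M ^ 3"
    using degree_cost_le[OF assms(3,4), of k0] index_cost_le[OF assms(3,4), of k0] max_cost_le[OF assms(3,4)]
      max_cost_le[OF assms(1,2)] M assms(4)
    unfolding cancel_cost_def accept_cost_def max_def by (auto split: if_splits)
  ultimately show ?thesis
    using betti_cost_le[OF assms(3,4)] step_bound_ge[of M] M assms(2)
      card_vertices_le[OF assms(1)]
    unfolding removal_cost_def by linarith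
qed

text \<open>
  Every passage through the loop makes one vertex inactive, by deleting it or by setting its
  index to \<open>-1\<close>, and no vertex becomes active again: the number of active vertices, weighted by
  the cost of one passage, is a potential for the number of operations.
\<close>

lemma reaches_cost_le:
  fixes F :: "'f::field itself" and S :: "'v::linorder set set"
  assumes "reaches F rc k0 S L c s" and fin: "finite S" and card: "card S < M"
    and L: "distinct L" "set L \<subseteq> vertices S"
  shows "case s of
      Loop S' I \<Rightarrow> S' \<subseteq> S \<and>
        c + card (active S' I) * step_bound M \<le> step_bound M + card (vertices S) * step_bound M
    | Output S' \<Rightarrow> c \<le> 2 * step_bound M + card (vertices S) * step_bound M"
  using assms(1)
proof (induction rule: reaches.induct)
  case init
  \<comment> \<open>Initially at most all vertices are active; the separate summand
    \<open>step_bound M\<close> pays for the initialisation.\<close>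
  have "card (active S I) * step_bound M \<le> card (vertices S) * step_bound M" for I
    using finite_vertices[OF fin] by (intro mult_le_mono card_mono) (auto simp: active_def)
  with init_cost_le[OF fin card L] show ?case
    by (simp add: add_mono)
next
  case (step c s c' s')
  \<comment> \<open>The amortised step: the loss of one active vertex releases
    \<open>step_bound M\<close>, which pays for the operations \<open>c'\<close> of the
    passage.\<close>
  have weight: "(c + c') + card A' * step_bound M \<le> b"
    if "c' \<le> step_bound M" "Suc (card A') \<le> card A" "c + card A * step_bound M \<le> b"
    for A A' :: "'v set" and b
  proof -
    have "Suc (card A') * step_bound M \<le> card A * step_bound M"
      using that(2) by (rule mult_le_mono1)
    with that show ?thesis
      by simp
  qed
  from step.hyps(2) show ?case
  proof cases
    case (cancel S1 I x S')
    have S1: "S1 \<subseteq> S"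
      and c: "c + card (active S1 I) * step_bound M
        \<le> step_bound M + card (vertices S) * step_bound M"
      using step.IH cancel by auto
    have fin1: "finite S1" and card1: "card S1 < M"
      using S1 fin card card_mono[OF fin S1] by (auto intro: finite_subset)
    have sub: "S' \<subseteq> S1"
      using cancel by (auto simp: remove_vertex_def)
    have fin': "finite S'" and card': "card S' < M"
      using sub fin1 card1 card_mono[OF fin1 sub] by (auto intro: finite_subset)
    have "c' \<le> step_bound M"
      using removal_cost_le[OF fin1 card1 fin' card'] cancel by simp
    moreover have "Suc (card (active S1 (I(x := -1)))) \<le> card (active S1 I)"
      using cancel by (intro card_active_cancel[OF fin1]) auto
    ultimately show ?thesis
      using weight c S1 cancel by simp
  next
    case (accept S1 I x S')
    have S1: "S1 \<subseteq> S"
      and c: "c + card (active S1 I) * step_bound M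
        \<le> step_bound M + card (vertices S) * step_bound M"
      using step.IH accept by auto
    have fin1: "finite S1" and card1: "card S1 < M"
      using S1 fin card card_mono[OF fin S1] by (auto intro: finite_subset)
    have sub: "S' \<subseteq> S1"
      using accept by (auto simp: remove_vertex_def)
    have fin': "finite S'" and card': "card S' < M"
      using sub fin1 card1 card_mono[OF fin1 sub] by (auto intro: finite_subset)
    have "c' \<le> step_bound M"
      using removal_cost_le[OF fin1 card1 fin' card'] accept by simp
    moreover have "Suc (card (active S' (\<lambda>y. if I y = -1 then -1 else vertex_index k0 S' y)))
        \<le> card (active S1 I)"
      using accept card_active_accept[OF fin1] by auto
    ultimately show ?thesis
      using weight c S1 sub accept by simp
  next
    case (halt S1 I)
    have S1: "S1 \<subseteq> S"
      and c: "c + card (active S1 I) * step_bound M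
        \<le> step_bound M + card (vertices S) * step_bound M"
      using step.IH halt by auto
    \<comment> \<open>Writing the output costs the size of the current complex. This final charge is
      the second \<open>step_bound M\<close> in the bound for \<open>Output\<close>.\<close>
    have "M \<le> M ^ 3"
      using card by (auto simp: power3_eq_cube)
    also have "M ^ 3 \<le> step_bound M"
      by (simp add: step_bound_def)
    finally have "card S1 \<le> step_bound M"
      using card card_mono[OF fin S1] by linarith
    with c halt show ?thesis
      by simp
  qed
qed

text \<open>The fourth power arises from fewer than \<open>M\<close> passages of cubic cost. The
  potential bound holds at every reachable configuration, hence also for the partial executions in
  the supremum.\<close>

lemma complexity_le:
  fixes F :: "'f::field itself" and S :: "'v::linorder set set"
  assumes "finite S" and "card S < M"
  shows "complexity F rc k0 S \<le> ereal (2 * real ((k0 + 2) * (K + 15)) * real M ^ 4)"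
  unfolding complexity_def
proof (rule Sup_least)
  fix y
  assume "y \<in> {ereal (real c) | c L s.
            distinct L \<and> set L \<subseteq> vertices S \<and> reaches F rc k0 S L c s}"
  then obtain c L s where y: "y = ereal (real c)"
    and L: "distinct L" "set L \<subseteq> vertices S" and "reaches F rc k0 S L c s"
    by auto
  from reaches_cost_le[OF this(4) assms L]
  have "c \<le> 2 * step_bound M + card (vertices S) * step_bound M"
    by (cases s) auto
  also have "\<dots> = (2 + card (vertices S)) * step_bound M"
    by simp
  \<comment> \<open>Here \<open>card (vertices S) + 1 \<le> M\<close> and
    \<open>1 \<le> M\<close>.\<close>
  also have "\<dots> \<le> (2 * M) * step_bound M"
    using card_vertices_le[OF assms(1)] assms(2) by (intro mult_le_mono1) linarith
  also have "\<dots> = 2 * ((k0 + 2) * (K + 15)) * M ^ 4"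
    by (simp add: step_bound_def algebra_simps power_numeral_reduce)
  finally have "real c \<le> real (2 * ((k0 + 2) * (K + 15)) * M ^ 4)"
    by (rule of_nat_mono)
  then show "y \<le> ereal (2 * real ((k0 + 2) * (K + 15)) * real M ^ 4)"
    unfolding y by (simp only: of_nat_mult of_nat_power of_nat_numeral ereal_less_eq mult.assoc)
qed

end


section \<open>The number of simplices\<close>

lemma measurable_torus [measurable]: "(torus a :: (real ^ 'd::finite) set) \<in> sets borel"
proof -
  have "(torus a :: (real ^ 'd) set) = (\<Inter>i. {x. 0 \<le> x $ i} \<inter> {x. x $ i < a})"
    by (auto simp: torus_def)
  also have "\<dots> \<in> sets borel"
    by (intro sets.countable_INT' sets.Int borel_closed borel_open)
       (auto intro!: closed_Collect_le open_Collect_less continuous_intros)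
  finally show ?thesis .
qed

lemma inner_vec_Basis: "b \<in> Basis \<Longrightarrow> (vec c :: real ^ 'd::finite) \<bullet> b = c"
  by (auto simp: Basis_vec_def inner_axis)

lemma emeasure_lborel_cube:
  assumes "0 \<le> s"
  shows "emeasure lborel (box y (y + vec s :: real ^ 'd::finite)) = ennreal (s ^ CARD('d))"
  using assms by (subst emeasure_lborel_box) (auto simp: inner_vec_Basis inner_add_left)

text \<open>The half-open cube lies between the open and the closed cube, which have the same
  volume.\<close>

lemma emeasure_lborel_torus:
  assumes "0 < a"
  shows "emeasure lborel (torus a :: (real ^ 'd::finite) set) = ennreal (a ^ CARD('d))"
proof (rule antisym)
  have "emeasure lborel (torus a :: (real ^ 'd) set) \<le> emeasure lborel (cbox 0 (vec a :: real ^ 'd))"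
    by (intro emeasure_mono) (auto simp: torus_def mem_box_cart less_imp_le)
  also have "\<dots> = ennreal (a ^ CARD('d))"
    using assms by (subst emeasure_lborel_cbox) (auto simp: inner_vec_Basis)
  finally show "emeasure lborel (torus a :: (real ^ 'd) set) \<le> ennreal (a ^ CARD('d))" .
  have "ennreal (a ^ CARD('d)) = emeasure lborel (box 0 (0 + vec a :: real ^ 'd))"
    using assms by (subst emeasure_lborel_cube) auto
  also have "\<dots> \<le> emeasure lborel (torus a :: (real ^ 'd) set)"
    by (intro emeasure_mono) (auto simp: torus_def mem_box_cart less_imp_le)
  finally show "ennreal (a ^ CARD('d)) \<le> emeasure lborel (torus a :: (real ^ 'd) set)" .
qed

lemma prob_space_uniform_torus:
  assumes "0 < a"
  shows "prob_space (uniform_measure lborel (torus a :: (real ^ 'd::finite) set))"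
  using assms by (intro prob_space_uniform_measure) (auto simp: emeasure_lborel_torus)

section \<open>The torus distance: measurability and volume of balls\<close>

lemma countable_integer_points: "countable {z :: real ^ 'd::finite. \<forall>i. z $ i \<in> \<int>}"
proof -
  have "{z :: real ^ 'd. \<forall>i. z $ i \<in> \<int>} \<subseteq> range (\<lambda>f. \<chi> i. of_int (f i))"
  proof
    fix z :: "real ^ 'd"
    assume "z \<in> {z. \<forall>i. z $ i \<in> \<int>}"
    then show "z \<in> range (\<lambda>f. \<chi> i. of_int (f i))"
      by (intro range_eqI[of _ _ "\<lambda>i. \<lfloor>z $ i\<rfloor>"]) (auto simp: vec_eq_iff)
  qed
  then show ?thesis
    by (rule countable_subset) simp
qed

lemma bdd_below_torus_dist:
  "bdd_below ((\<lambda>z. infnorm (x - y + a *\<^sub>R z)) ` A)" for x y :: "real ^ 'd::finite"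
  by (intro bdd_belowI[of _ 0]) (auto simp: infnorm_pos_le)

text \<open>The distance is a pointwise infimum of continuous functions over the countable lattice,
  bounded below by 0.\<close>

lemma measurable_torus_dist:
  "case_prod (torus_dist a) \<in> borel_measurable (borel \<Otimes>\<^sub>M (borel :: (real ^ 'd::finite) measure))"
  unfolding torus_dist_def case_prod_unfold
proof (rule borel_measurable_cINF)
  show "countable {z :: real ^ 'd. \<forall>i. z $ i \<in> \<int>}"
    by (rule countable_integer_points)
  fix z :: "real ^ 'd"
  have "continuous_on UNIV (infnorm :: real ^ 'd \<Rightarrow> real)"
    by (intro continuous_at_imp_continuous_on) (auto simp: continuous_infnorm)
  then have [measurable]: "(infnorm :: real ^ 'd \<Rightarrow> real) \<in> borel_measurable borel"
    by (rule borel_measurable_continuous_onI)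
  show "(\<lambda>p. infnorm (fst p - snd p + a *\<^sub>R z)) \<in> borel_measurable (borel \<Otimes>\<^sub>M borel)"
    by measurable
qed (use bdd_below_torus_dist in auto)

text \<open>
  The cubes have half side \<open>2 * r\<close> instead of \<open>r\<close>, so that it does not matter whether the
  infimum in the distance is attained.  The \<open>3 ^ d\<close> cubes of side \<open>4 * r\<close> give the constant 12
  in the estimates below.
\<close>

lemma torus_dist_le_imp:
  fixes x y :: "real ^ 'd::finite"
  assumes "torus_dist a x y \<le> r" and "0 < r" and "2 * r \<le> a"
    and "x \<in> torus a" and "y \<in> torus a"
  shows "\<exists>z. (\<forall>i. z i \<in> {-1, 0, 1}) \<and>
    y \<in> box ((\<chi> i. x $ i + a * z i - 2 * r)) ((\<chi> i. x $ i + a * z i - 2 * r) + vec (4 * r))"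
proof -
  have "torus_dist a x y < 2 * r"
    using assms(1,2) by linarith
  then obtain z where z: "\<And>i. z $ i \<in> \<int>" and less: "infnorm (x - y + a *\<^sub>R z) < 2 * r"
    unfolding torus_dist_def
    by (subst (asm) cINF_less_iff[OF _ bdd_below_torus_dist]) (auto intro: exI[of _ 0])
  have comp: "\<bar>x $ i - y $ i + a * z $ i\<bar> < 2 * r" for i
    using component_le_infnorm_cart[of "x - y + a *\<^sub>R z" i] less by simp
  \<comment> \<open>Coordinates of \<open>x - y\<close> lie strictly between \<open>-a\<close> and
    \<open>a\<close>, and \<open>2 * r \<le> a\<close>, so \<open>a * z $ i\<close> lies strictly
    between \<open>-2 * a\<close> and \<open>2 * a\<close>.\<close>
  have "z $ i \<in> {-1, 0, 1}" for i
  proof -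
    obtain m :: int where m: "z $ i = of_int m"
      using z[of i] by (auto elim: Ints_cases)
    have "0 \<le> x $ i" "x $ i < a" "0 \<le> y $ i" "y $ i < a"
      using assms(4,5) by (auto simp: torus_def)
    then have "a * z $ i < a * 2" "a * (-2) < a * z $ i"
      using comp[of i] assms(3) unfolding abs_less_iff by linarith+
    moreover have "0 < a"
      using assms(2,3) by linarith
    ultimately have "z $ i < 2" "-2 < z $ i"
      by (simp_all only: mult_less_cancel_left_pos)
    with m have "m < 2" "-2 < m"
      by linarith+
    then have "m \<in> {-1, 0, 1}"
      by auto
    with m show ?thesis
      by auto
  qed
  moreover have "y \<in> box (\<chi> i. x $ i + a * z $ i - 2 * r)
      ((\<chi> i. x $ i + a * z $ i - 2 * r) + vec (4 * r))"
    unfolding mem_box_cart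
  proof
    fix i
    show "(\<chi> i. x $ i + a * z $ i - 2 * r) $ i < y $ i \<and>
        y $ i < ((\<chi> i. x $ i + a * z $ i - 2 * r) + vec (4 * r)) $ i"
      using comp[of i] unfolding abs_less_iff by auto
  qed
  ultimately show ?thesis
    by blast
qed

lemma measurable_torus_dist_section:
  "(\<lambda>y. torus_dist a x y) \<in> borel_measurable (borel :: (real ^ 'd::finite) measure)"
  using measurable_compose[OF measurable_Pair1'[of x borel borel] measurable_torus_dist[of a]]
  by simp

lemma emeasure_torus_ball_le:
  fixes x :: "real ^ 'd::finite"
  assumes "0 < a" and "0 < r" and "2 * r \<le> a" and "x \<in> torus a"
  shows "emeasure (uniform_measure lborel (torus a)) {y. torus_dist a x y \<le> r}
           \<le> ennreal ((12 * r / a) ^ CARD('d))"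
proof -
  have [measurable]: "{y. torus_dist a x y \<le> r} \<in> sets borel"
    using measurable_torus_dist_section[of a x] by measurable
  define Z :: "('d \<Rightarrow> real) set" where "Z = UNIV \<rightarrow>\<^sub>E {-1, 0, 1}"
  define c :: "('d \<Rightarrow> real) \<Rightarrow> real ^ 'd" where "c z = (\<chi> i. x $ i + a * z i - 2 * r)" for z
  have finZ: "finite Z" and cardZ: "card Z = 3 ^ CARD('d)"
    unfolding Z_def by (auto intro: finite_PiE simp: card_PiE numeral_3_eq_3)
  \<comment> \<open>The ball is covered by cubes around \<open>x\<close> and its neighbouring
    lattice translates. A union bound suffices; the cubes may overlap or leave the torus.\<close>
  have "torus a \<inter> {y. torus_dist a x y \<le> r} \<subseteq> (\<Union>z\<in>Z. box (c z) (c z + vec (4 * r)))"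
    using torus_dist_le_imp[of a x _ r] assms(2-4) unfolding Z_def c_def by (fastforce simp: PiE_def)
  then have "emeasure lborel (torus a \<inter> {y. torus_dist a x y \<le> r})
      \<le> emeasure lborel (\<Union>z\<in>Z. box (c z) (c z + vec (4 * r)))"
    using finZ by (intro emeasure_mono) (auto intro!: sets.finite_UN)
  also have "\<dots> \<le> (\<Sum>z\<in>Z. emeasure lborel (box (c z) (c z + vec (4 * r))))"
    using finZ by (intro emeasure_subadditive_finite) auto
  also have "\<dots> = (\<Sum>z\<in>Z. ennreal ((4 * r) ^ CARD('d)))"
    using assms(2) by (intro sum.cong emeasure_lborel_cube) auto
  also have "\<dots> = ennreal ((12 * r) ^ CARD('d))"
  proof -
    have "(\<Sum>z\<in>Z. ennreal ((4 * r) ^ CARD('d))) = ennreal (\<Sum>z\<in>Z. (4 * r) ^ CARD('d))"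
      using assms(2) by (intro sum_ennreal) simp
    also have "(\<Sum>z\<in>Z. (4 * r) ^ CARD('d)) = (3 * (4 * r)) ^ CARD('d)"
      unfolding power_mult_distrib sum_constant cardZ by simp
    finally show ?thesis
      by simp
  qed
  finally have "emeasure lborel (torus a \<inter> {y. torus_dist a x y \<le> r})
        / emeasure lborel (torus a :: (real ^ 'd) set)
      \<le> ennreal ((12 * r) ^ CARD('d)) / emeasure lborel (torus a :: (real ^ 'd) set)"
    by (rule divide_right_mono_ennreal)
  also have "\<dots> = ennreal ((12 * r / a) ^ CARD('d))"
    using assms(1,2) by (simp add: emeasure_lborel_torus divide_ennreal power_divide)
  finally show ?thesis
    by (subst emeasure_uniform_measure) auto
qed

section \<open>Cliques in the binomial process\<close>

lemma prob_space_binomial_process: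
  assumes "0 < a"
  shows "prob_space (binomial_process a n :: (nat \<Rightarrow> real ^ 'd::finite) measure)"
  unfolding binomial_process_def by (intro prob_space_PiM prob_space_uniform_torus assms)

lemma measurable_torus_dist_points:
  assumes "i \<in> I" and "j \<in> I"
  shows "(\<lambda>X. torus_dist b (X i) (X j))
    \<in> borel_measurable (Pi\<^sub>M I (\<lambda>_. uniform_measure lborel (torus a :: (real ^ 'd::finite) set)))"
proof -
  have comp: "(\<lambda>X. X k) \<in> borel_measurable
      (Pi\<^sub>M I (\<lambda>_. uniform_measure lborel (torus a :: (real ^ 'd) set)))" if "k \<in> I" for k
  proof -
    have "(\<lambda>X. X k) \<in> measurable
      (Pi\<^sub>M I (\<lambda>_. uniform_measure lborel (torus a :: (real ^ 'd) set)))
      (uniform_measure lborel (torus a :: (real ^ 'd) set))"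
      using that by (rule measurable_component_singleton)
    then show ?thesis
      by (simp cong: measurable_cong_sets)
  qed
  show ?thesis
    using measurable_compose[OF measurable_Pair[OF comp[OF assms(1)] comp[OF assms(2)]]
      measurable_torus_dist[of b]] by simp
qed

text \<open>Single out a vertex \<open>i\<close> of the simplex and keep only the distances to
  \<open>i\<close>. Given its position, the other \<open>card \<sigma> - 1\<close> points fall
  independently into the ball around it.\<close>

lemma emeasure_clique_le:
  assumes "0 < a" and "0 < r" and "2 * r \<le> a" and "\<sigma> \<subseteq> {..<n}" and "\<sigma> \<noteq> {}"
  shows "emeasure (binomial_process a n) {X \<in> space (binomial_process a n).
      \<sigma> \<in> torus_rips a r n (X :: nat \<Rightarrow> real ^ 'd::finite)}
    \<le> ennreal (((12 * r / a) ^ CARD('d)) ^ (card \<sigma> - 1))" (is "emeasure ?M ?E \<le> _")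
proof -
  let ?U = "uniform_measure lborel (torus a :: (real ^ 'd) set)"
  define q where "q = (12 * r / a) ^ CARD('d)"
  have q: "0 \<le> q"
    unfolding q_def using assms by simp
  interpret U: prob_space ?U
    by (rule prob_space_uniform_torus[OF assms(1)])
  interpret product_sigma_finite "\<lambda>_::nat. ?U"
    by standard
  from assms(5) obtain i where i: "i \<in> \<sigma>"
    by blast
  define J where "J = {..<n} - {i}"
  have J: "finite J" "i \<notin> J" "insert i J = {..<n}"
    using i assms(4) by (auto simp: J_def)
  have J_\<sigma>: "J \<inter> \<sigma> = \<sigma> - {i}"
    using assms(4) by (auto simp: J_def)
  \<comment> \<open>Points outside \<open>\<sigma>\<close> get the constant factor 1, so the product
    can run over all of \<open>J\<close>.\<close>
  define f :: "real ^ 'd \<Rightarrow> nat \<Rightarrow> real ^ 'd \<Rightarrow> ennreal" where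
    "f y j = (if j \<in> \<sigma> then indicator {x. torus_dist a y x \<le> r} else (\<lambda>_. 1))" for y j
  have M: "?M = Pi\<^sub>M (insert i J) (\<lambda>_. ?U)"
    unfolding binomial_process_def J(3) ..
  have ball [measurable]: "{x. torus_dist a y x \<le> r} \<in> sets (borel :: (real ^ 'd) measure)" for y
    using measurable_torus_dist_section[of a y] by measurable
  have f [measurable]: "f y j \<in> borel_measurable ?U" for y j
    unfolding f_def by auto
  have f_pair: "(\<lambda>X. f (X i) j (X j)) \<in> borel_measurable (Pi\<^sub>M (insert i J) (\<lambda>_. ?U))"
    if "j \<in> J" for j
  proof -
    have [measurable]: "(\<lambda>X. torus_dist a (X i) (X j))
        \<in> borel_measurable (Pi\<^sub>M (insert i J) (\<lambda>_. ?U))"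
      using that by (intro measurable_torus_dist_points) auto
    have "(\<lambda>X. f (X i) j (X j)) = (\<lambda>X. if j \<in> \<sigma> then
        if torus_dist a (X i) (X j) \<le> r then 1 else 0 else 1)"
      by (auto simp: f_def fun_eq_iff)
    then show ?thesis
      by simp
  qed
  have "emeasure ?M ?E \<le> (\<integral>\<^sup>+X. (\<Prod>j\<in>J. f (X i) j (X j)) \<partial>?M)"
  \<comment> \<open>A nonmeasurable set has \<open>emeasure\<close> 0, so the estimate holds without
    first proving that \<open>?E\<close> is an event.\<close>
  proof (cases "?E \<in> sets ?M")
    case True
    then have "emeasure ?M ?E = (\<integral>\<^sup>+X. indicator ?E X \<partial>?M)"
      by simp
    also have "\<dots> \<le> (\<integral>\<^sup>+X. (\<Prod>j\<in>J. f (X i) j (X j)) \<partial>?M)"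
    proof (rule nn_integral_mono)
      fix X
      have "(\<Prod>j\<in>J. f (X i) j (X j)) = 1" if "X \<in> ?E"
      proof (intro prod.neutral ballI)
        fix j
        assume "j \<in> J"
        with J(2) have "i \<noteq> j"
          by blast
        with that i have "torus_dist a (X i) (X j) \<le> r" if "j \<in> \<sigma>"
          using \<open>j \<in> \<sigma>\<close> by (auto simp: torus_rips_def vietoris_rips_def)
        then show "f (X i) j (X j) = 1"
          by (simp add: f_def)
      qed
      then show "indicator ?E X \<le> (\<Prod>j\<in>J. f (X i) j (X j))"
        by (cases "X \<in> ?E") auto
    qed
    finally show ?thesis .
  qed (simp add: emeasure_notin_sets)
  \<comment> \<open>Fubini, with the position \<open>y\<close> of the point \<open>i\<close> in the
    outer integral; the inner integral then factorises by independence.\<close>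
  also have "\<dots> = (\<integral>\<^sup>+y. (\<integral>\<^sup>+X. (\<Prod>j\<in>J. f ((X(i := y)) i) j ((X(i := y)) j))
      \<partial>Pi\<^sub>M J (\<lambda>_. ?U)) \<partial>?U)"
    unfolding M using J f_pair
    by (intro product_nn_integral_insert_rev borel_measurable_prod) auto
  also have "\<dots> = (\<integral>\<^sup>+y. (\<integral>\<^sup>+X. (\<Prod>j\<in>J. f y j (X j)) \<partial>Pi\<^sub>M J (\<lambda>_. ?U)) \<partial>?U)"
    using J(2) by (intro nn_integral_cong prod.cong) auto
  also have "\<dots> = (\<integral>\<^sup>+y. (\<Prod>j\<in>J. \<integral>\<^sup>+x. f y j x \<partial>?U) \<partial>?U)"
    using J(1) f by (intro nn_integral_cong product_nn_integral_prod) auto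
  also have "\<dots> \<le> (\<integral>\<^sup>+y. ennreal (q ^ (card \<sigma> - 1)) \<partial>?U)"
  \<comment> \<open>The ball estimate requires a centre in the torus, which holds almost everywhere
    for the uniform measure.\<close>
  proof (rule nn_integral_mono_AE, rule AE_uniform_measureI, measurable, rule AE_I2, rule impI)
    fix y :: "real ^ 'd"
    assume y: "y \<in> torus a"
    have "(\<Prod>j\<in>J. \<integral>\<^sup>+x. f y j x \<partial>?U) \<le> (\<Prod>j\<in>J. if j \<in> \<sigma> then ennreal q else 1)"
    proof (intro prod_mono_ennreal)
      fix j
      have "emeasure ?U {x. torus_dist a y x \<le> r} \<le> ennreal q"
        unfolding q_def by (intro emeasure_torus_ball_le assms y)
      moreover have "emeasure ?U UNIV = 1"
        using U.emeasure_space_1 by simp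
      ultimately show "(\<integral>\<^sup>+x. f y j x \<partial>?U) \<le> (if j \<in> \<sigma> then ennreal q else 1)"
        by (auto simp: f_def)
    qed
    also have "\<dots> = ennreal q ^ card (J \<inter> \<sigma>)"
      using J(1) by (simp add: prod.If_cases)
    also have "\<dots> = ennreal (q ^ (card \<sigma> - 1))"
      using q i by (simp add: J_\<sigma> ennreal_power)
    finally show "(\<Prod>j\<in>J. \<integral>\<^sup>+x. f y j x \<partial>?U) \<le> ennreal (q ^ (card \<sigma> - 1))" .
  qed
  also have "\<dots> = ennreal (q ^ (card \<sigma> - 1))"
    using U.emeasure_space_1 by simp
  finally show ?thesis
    unfolding q_def .
qed

section \<open>Measurability and size of the random complex\<close>

lemma torus_rips_subset: "torus_rips a r n X \<subseteq> Pow {..<n} - {{}}"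
  by (auto simp: torus_rips_def vietoris_rips_def)

lemma finite_torus_rips: "finite (torus_rips a r n X)"
  by (rule finite_subset[OF torus_rips_subset]) simp

text \<open>The complex takes finitely many values, so only preimages of single complexes need
  checking. Each is described by finitely many conditions on pairwise distances.\<close>

lemma measurable_torus_rips:
  "torus_rips a r n \<in> measurable (binomial_process a n :: (nat \<Rightarrow> real ^ 'd::finite) measure)
     (count_space (Pow (Pow {..<n})))" (is "_ \<in> measurable ?M _")
proof (subst measurable_count_space_eq_countable)
  show "countable (Pow (Pow {..<n}))"
    by (intro countable_finite) simp
  have simplex: "Measurable.pred ?M (\<lambda>X. \<sigma> \<in> torus_rips a r n X)" if "\<sigma> \<subseteq> {..<n}" for \<sigma>
  proof -
    have fin: "finite \<sigma>"
      using that by (rule finite_subset) simp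
    define Q where "Q = (\<lambda>X :: nat \<Rightarrow> real ^ 'd.
      \<forall>x\<in>\<sigma>. \<forall>y\<in>\<sigma>. x \<noteq> y \<longrightarrow> torus_dist a (X x) (X y) \<le> r)"
    have [measurable]: "Measurable.pred ?M Q"
      unfolding Q_def
    proof (intro pred_intros_finite fin)
      fix x y
      assume "x \<in> \<sigma>" "y \<in> \<sigma>"
      with that have [measurable]: "(\<lambda>X. torus_dist a (X x) (X y)) \<in> borel_measurable ?M"
        unfolding binomial_process_def by (intro measurable_torus_dist_points) auto
      show "Measurable.pred ?M (\<lambda>X. x \<noteq> y \<longrightarrow> torus_dist a (X x) (X y) \<le> r)"
        by measurable
    qed
    have eq: "(\<lambda>X. \<sigma> \<in> torus_rips a r n X) = (\<lambda>X. \<sigma> \<noteq> {} \<and> Q X)"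
      using that fin unfolding torus_rips_def vietoris_rips_def Q_def by blast
    show ?thesis
      unfolding eq by measurable
  qed
  have sub: "torus_rips a r n X \<subseteq> Pow {..<n}" for X :: "nat \<Rightarrow> real ^ 'd"
    using torus_rips_subset[of a r n X] by (rule subset_trans) (rule Diff_subset)
  have "torus_rips a r n -` {T} \<inter> space ?M \<in> sets ?M" if T: "T \<subseteq> Pow {..<n}" for T
  proof -
    have eq: "A = T \<longleftrightarrow> (\<forall>\<sigma>\<in>B. \<sigma> \<in> A \<longleftrightarrow> \<sigma> \<in> T)" if "A \<subseteq> B" "T \<subseteq> B" for A B :: "nat set set"
      using that by blast
    have "torus_rips a r n -` {T} \<inter> space ?M =
        {X \<in> space ?M. \<forall>\<sigma>\<in>Pow {..<n}. \<sigma> \<in> torus_rips a r n X \<longleftrightarrow> \<sigma> \<in> T}"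
      unfolding eq[OF sub T, symmetric] by (simp add: vimage_def Int_def conj_commute)
    also have "\<dots> \<in> sets ?M"
    proof (intro predE pred_intros_finite)
      fix \<sigma> :: "nat set"
      assume "\<sigma> \<in> Pow {..<n}"
      then have [measurable]: "Measurable.pred ?M (\<lambda>X. \<sigma> \<in> torus_rips a r n X)"
        by (intro simplex) auto
      show "Measurable.pred ?M (\<lambda>X. \<sigma> \<in> torus_rips a r n X \<longleftrightarrow> \<sigma> \<in> T)"
        by measurable
    qed simp
    finally show ?thesis .
  qed
  then show "torus_rips a r n \<in> space ?M \<rightarrow> Pow (Pow {..<n}) \<and>
    (\<forall>T\<in>Pow (Pow {..<n}). torus_rips a r n -` {T} \<inter> space ?M \<in> sets ?M)"
    using sub by simp
qed

text \<open>Every subset of a count space is measurable, so \<open>P\<close> is arbitrary; in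
  particular, bounds on \<open>complexity\<close> define events.\<close>

lemma pred_torus_rips:
  "Measurable.pred (binomial_process a n :: (nat \<Rightarrow> real ^ 'd::finite) measure)
     (\<lambda>X. P (torus_rips a r n X))"
  by (rule measurable_compose[OF measurable_torus_rips]) simp

text \<open>By linearity, the expectation is a sum of simplex probabilities. After multiplication by
  \<open>q\<close>, the clique bounds become the terms of the binomial expansion of
  \<open>(1 + q) ^ n\<close> without the empty set.\<close>

lemma expectation_card_torus_rips_le:
  assumes "0 < a" and "0 < r" and "2 * r \<le> a" and q: "q = (12 * r / a) ^ CARD('d::finite)"
  shows "(\<integral>X. real (card (torus_rips a r n X)) \<partial>(binomial_process a n :: (nat \<Rightarrow> real ^ 'd) measure))
           \<le> exp (real n * q) / q" (is "integral\<^sup>L ?M _ \<le> _")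
proof -
  interpret prob_space ?M
    by (rule prob_space_binomial_process[OF assms(1)])
  have q0: "0 < q"
    unfolding q using assms by simp
  let ?E = "\<lambda>\<sigma>. {X \<in> space ?M. \<sigma> \<in> torus_rips a r n X}"
  let ?P = "Pow {..<n} - {{}}"
  have E: "?E \<sigma> \<in> events" for \<sigma>
    by (intro predE pred_torus_rips)
  have "integral\<^sup>L ?M (\<lambda>X. real (card (torus_rips a r n X)))
      = integral\<^sup>L ?M (\<lambda>X. \<Sum>\<sigma>\<in>?P. indicator (?E \<sigma>) X)"
  proof (rule Bochner_Integration.integral_cong[OF refl])
    fix X
    assume X: "X \<in> space ?M"
    have "real (card A) = (\<Sum>\<sigma>\<in>P. of_bool (\<sigma> \<in> A))" if "A \<subseteq> P" "finite P" for A P :: "nat set set"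
      using that by (simp add: Int_absorb1)
    from this[OF torus_rips_subset]
    have "real (card (torus_rips a r n X)) = (\<Sum>\<sigma>\<in>?P. of_bool (\<sigma> \<in> torus_rips a r n X))"
      by simp
    also have "\<dots> = (\<Sum>\<sigma>\<in>?P. indicator (?E \<sigma>) X)"
      using X by (intro sum.cong) auto
    finally show "real (card (torus_rips a r n X)) = (\<Sum>\<sigma>\<in>?P. indicator (?E \<sigma>) X)" .
  qed
  also have "\<dots> = (\<Sum>\<sigma>\<in>?P. prob (?E \<sigma>))"
    using E by (subst Bochner_Integration.integral_sum) (auto simp: integrable_indicator_iff less_top[symmetric])
  also have "\<dots> \<le> (\<Sum>\<sigma>\<in>?P. q ^ (card \<sigma> - 1))"
  proof (rule sum_mono)
    fix \<sigma>
    assume "\<sigma> \<in> ?P"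
    then have "emeasure ?M (?E \<sigma>) \<le> ennreal (q ^ (card \<sigma> - 1))"
      unfolding q using assms(1-3) by (intro emeasure_clique_le) auto
    then show "prob (?E \<sigma>) \<le> q ^ (card \<sigma> - 1)"
      using q0 by (simp add: emeasure_eq_measure)
  qed
  also have "\<dots> \<le> exp (real n * q) / q"
  proof -
    have "q * q ^ (card \<sigma> - 1) = q ^ card \<sigma>" if "\<sigma> \<in> ?P" for \<sigma>
    proof -
      have "finite \<sigma>" "\<sigma> \<noteq> {}"
        using that by (auto intro: finite_subset)
      then have "0 < card \<sigma>"
        by auto
      then show ?thesis
        by (cases "card \<sigma>") auto
    qed
    then have "(\<Sum>\<sigma>\<in>?P. q ^ (card \<sigma> - 1)) * q = (\<Sum>\<sigma>\<in>?P. q ^ card \<sigma>)"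
      by (simp add: sum_distrib_left mult.commute[of _ q])
    also have "\<dots> \<le> (\<Sum>\<sigma>\<in>Pow {..<n}. q ^ card \<sigma>)"
      using q0 by (intro sum_mono2) auto
    \<comment> \<open>Expanding the product chooses \<open>q\<close> on a subset and 1
      elsewhere.\<close>
    also have "\<dots> = (\<Prod>i\<in>{..<n}. q + 1)"
      by (subst prod_add) auto
    also have "\<dots> = (1 + q) ^ n"
      by (simp add: add.commute)
    also have "\<dots> \<le> exp q ^ n"
      using q0 by (intro power_mono exp_ge_add_one_self) auto
    also have "\<dots> = exp (real n * q)"
      by (rule exp_of_nat_mult[symmetric])
    finally show ?thesis
      using q0 by (simp add: pos_le_divide_eq)
  qed
  finally show ?thesis .
qed

text \<open>Markov's inequality. For \<open>q\<close> of order \<open>1 / n\<close> and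
  \<open>m = n\<^sup>2\<close> the bound is of order \<open>1 / n\<close>.\<close>

lemma prob_many_simplices_le:
  assumes "0 < a" and "0 < r" and "2 * r \<le> a" and "q = (12 * r / a) ^ CARD('d::finite)"
    and "0 < m"
  shows "measure (binomial_process a n) {X \<in> space (binomial_process a n).
      m \<le> card (torus_rips a r n (X :: nat \<Rightarrow> real ^ 'd))} \<le> exp (real n * q) / (q * real m)"
    (is "measure ?M _ \<le> _")
proof -
  interpret prob_space ?M
    by (rule prob_space_binomial_process[OF assms(1)])
  have q0: "0 < q"
    using assms by simp
  have meas: "(\<lambda>X. real (card (torus_rips a r n X))) \<in> borel_measurable ?M"
    by (rule measurable_compose[OF measurable_torus_rips]) simp
  have "integrable ?M (\<lambda>X. real (card (torus_rips a r n X)))"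
  proof (rule integrable_const_bound[of _ "real (card (Pow {..<n} - {{}}))"])
    show "AE X in ?M. norm (real (card (torus_rips a r n X))) \<le> real (card (Pow {..<n} - {{}}))"
      using card_mono[OF _ torus_rips_subset[of a r n]] by (intro AE_I2) simp
  qed (rule meas)
  then have "measure ?M {X \<in> space ?M. real (card (torus_rips a r n X)) \<ge> real m}
      \<le> integral\<^sup>L ?M (\<lambda>X. real (card (torus_rips a r n X))) / real m"
    using assms(5) by (intro integral_Markov_inequality_measure[of _ _ "{}"]) auto
  also have "\<dots> \<le> (exp (real n * q) / q) / real m"
    by (intro divide_right_mono expectation_card_torus_rips_le assms(1-4)) simp
  finally show ?thesis
    by simp
qed

section \<open>Asymptotics in the critical regime\<close>

theorem theorem14:
  fixes k0 :: nat and a r \<theta> :: "nat \<Rightarrow> real" and rc :: "nat \<Rightarrow> nat \<Rightarrow> nat"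
  assumes side: "\<And>n. 0 < a n" and radius: "\<And>n. 0 < r n"
    and theta: "\<And>n. \<theta> n = (r n / a n) ^ CARD('d::finite)"
    and theta_le: "eventually (\<lambda>n. \<theta> n \<le> (1 / 2) ^ CARD('d)) sequentially"
    and critical: "\<theta> \<in> \<Theta>(\<lambda>n. 1 / real n)"
    and rank_cost: "\<exists>K. \<forall>p q. rc p q \<le> K * (p * q * min p q)"
  shows "\<exists>C::real. (\<lambda>n. \<P>(X in (binomial_process (a n) n :: (nat \<Rightarrow> real ^ 'd) measure).
            complexity TYPE('f::field) rc k0 (torus_rips (a n) (r n) n X)
              \<le> ereal (C * real n powr ln (real n)))) \<longlonglongrightarrow> 1"
proof -
  obtain K where K: "\<And>p q. rc p q \<le> K * (p * q * min p q)"
    using rank_cost by blast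
  define C where "C = 2 * real ((k0 + 2) * (K + 15))"
  define q where "q n = (12 * r n / a n) ^ CARD('d)" for n
  have q_\<theta>: "q n = 12 ^ CARD('d) * \<theta> n" for n
    unfolding q_def theta by (simp flip: power_mult_distrib)
  have \<theta>_pos: "0 < \<theta> n" for n
    unfolding theta using side[of n] radius[of n] by simp
  obtain c1 where c1: "0 < c1"
    and ub: "eventually (\<lambda>n. norm (\<theta> n) \<le> c1 * norm (1 / real n)) sequentially"
    using bigthetaD1[OF critical] by (elim landau_o.bigE)
  obtain c2 where c2: "0 < c2"
    and lb: "eventually (\<lambda>n. norm (\<theta> n) \<ge> c2 * norm (1 / real n)) sequentially"
    using bigthetaD2[OF critical] by (elim landau_omega.bigE)
  \<comment> \<open>\<open>D\<close> combines the upper bound \<open>12 ^ CARD('d) * c1\<close> on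
    \<open>n * q n\<close> in the exponent with the lower bound \<open>12 ^ CARD('d) * c2\<close> in
    the denominator.\<close>
  define D where "D = exp (12 ^ CARD('d) * c1) / (12 ^ CARD('d) * c2)"
  let ?M = "\<lambda>n. binomial_process (a n) n :: (nat \<Rightarrow> real ^ 'd) measure"
  let ?good = "\<lambda>n X. complexity TYPE('f) rc k0 (torus_rips (a n) (r n) n X)
    \<le> ereal (C * real n powr ln (real n))"
  \<comment> \<open>With fewer than \<open>n\<^sup>2\<close> simplices the cost is at most
    \<open>C * n ^ 8\<close>, and \<open>exp 8 \<le> real n\<close> means that the exponent
    \<open>ln n\<close> is at least 8.\<close>
  have bound: "\<P>(X in ?M n. ?good n X) \<ge> 1 - D / real n"
    if n: "exp 8 \<le> real n" and th: "\<theta> n \<le> (1 / 2) ^ CARD('d)"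
      and up: "norm (\<theta> n) \<le> c1 * norm (1 / real n)" and lo: "norm (\<theta> n) \<ge> c2 * norm (1 / real n)"
    for n
  proof -
    interpret prob_space "?M n"
      by (rule prob_space_binomial_process[OF side])
    have n0: "0 < real n" and n1: "1 \<le> real n"
      using n exp_gt_zero[of "8::real"] one_le_exp_iff[of "8::real"] by linarith+
    have "r n / a n \<le> 1 / 2"
      using th side[of n] radius[of n] unfolding theta by (simp add: power_mono_iff del: power_one_over)
    then have r: "2 * r n \<le> a n"
      using side[of n] by (simp add: field_simps)
    let ?few = "\<lambda>X. card (torus_rips (a n) (r n) n X) < n\<^sup>2"
    have few: "?good n X" if "?few X" for X
    proof -
      have "complexity TYPE('f) rc k0 (torus_rips (a n) (r n) n X) \<le> ereal (C * real (n\<^sup>2) ^ 4)"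
        unfolding C_def using K finite_torus_rips that by (rule complexity_le)
      also have "real (n\<^sup>2) ^ 4 = real n powr 8"
        using n0 by (simp add: powr_numeral flip: power_mult)
      also have "C * real n powr 8 \<le> C * real n powr ln (real n)"
        using n n0 n1 unfolding C_def by (intro mult_left_mono powr_mono) (auto simp: ln_ge_iff)
      finally show ?thesis
        by simp
    qed
    have q0: "0 < q n"
      unfolding q_\<theta> using \<theta>_pos[of n] by simp
    have nq: "real n * q n \<le> 12 ^ CARD('d) * c1" and qn: "12 ^ CARD('d) * c2 \<le> q n * real n"
      using up lo \<theta>_pos[of n] n0 unfolding q_\<theta> by (simp_all add: field_simps)
    have "prob {X \<in> space (?M n). n\<^sup>2 \<le> card (torus_rips (a n) (r n) n X)}
        \<le> exp (real n * q n) / (q n * real (n\<^sup>2))"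
      using side radius r q_def n0 by (intro prob_many_simplices_le) auto
    also have "\<dots> = exp (real n * q n) / (q n * real n) / real n"
      by (simp add: power2_eq_square)
    also have "\<dots> \<le> D / real n"
      unfolding D_def using nq qn c2 q0 n0
      by (intro divide_right_mono frac_le) auto
    finally have "1 - D / real n
        \<le> 1 - prob {X \<in> space (?M n). n\<^sup>2 \<le> card (torus_rips (a n) (r n) n X)}"
      by simp
    also have "\<dots> = prob {X \<in> space (?M n). ?few X}"
      using prob_neg[OF predE[OF pred_torus_rips[where P = "\<lambda>S. n\<^sup>2 \<le> card S"]]]
      by (simp add: not_le)
    \<comment> \<open>Few simplices imply the cost bound for all draws and all critical lists, so
      one event is contained in the other.\<close>
    also have "\<dots> \<le> \<P>(X in ?M n. ?good n X)"
      using few by (intro finite_measure_mono predE pred_torus_rips) auto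
    finally show ?thesis .
  qed
  have "(\<lambda>n. \<P>(X in ?M n. ?good n X)) \<longlonglongrightarrow> 1"
  proof (rule tendsto_sandwich)
    have "eventually (\<lambda>n. exp 8 \<le> real n) sequentially"
      using filterlim_real_sequentially unfolding filterlim_at_top by blast
    with theta_le ub lb
    show "eventually (\<lambda>n. 1 - D / real n \<le> \<P>(X in ?M n. ?good n X)) sequentially"
      by eventually_elim (rule bound)
    show "eventually (\<lambda>n. \<P>(X in ?M n. ?good n X) \<le> 1) sequentially"
      by (intro always_eventually allI prob_space.prob_le_1 prob_space_binomial_process side)
    have "(\<lambda>n. 1 - D / real n) \<longlonglongrightarrow> 1 - 0"
      by (intro tendsto_diff tendsto_const lim_const_over_n)
    then show "(\<lambda>n. 1 - D / real n) \<longlonglongrightarrow> 1"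
      by simp
  qed (rule tendsto_const)
  then show ?thesis
    by (rule exI)
qed

end
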